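(* In the lattice of subvarieties of $\mathbb{PBZL}^{\ast}$, the only cover of $V_{\mathbb{BZL}}(\mathbf{D}_3)$ that is included in $V_{\mathbb{BZL}}(\mathbb{AOL})$ is $V_{\mathbb{BZL}}(\mathbf{D}_4)$.
   Context: A pseudo-Kleene algebra is an algebra $(L,\wedge,\vee,{}',0,1)$ with a bounded lattice reduct and an order-reversing operation $'$ with $a''=a$ and $a\wedge a'\le b\vee b'$ for all $a,b$. A BZ-lattice is an algebra $(L,\wedge,\vee,{}',{}^{\sim},0,1)$ whose ${}^\sim$-free reduct is a pseudo-Kleene algebra and with ${}^\sim$ order-reversing and satisfying $a\wedge a^{\sim}=0$ and $a\le a^{\sim\sim}=a^{\sim\prime}$. A PBZ$^{\ast}$-lattice is a BZ-lattice that is paraorthomodular ($a\le b$ and $a'\wedge b=0$ imply $a=b$) and satisfies $(x\wedge x')^{\sim}\approx x^{\sim}\vee x'^{\sim}$; these form a variety $\mathbb{PBZL}^{\ast}$. An antiortholattice is a PBZ$^{\ast}$-lattice whose only sharp elements (elements $a$ with $a\vee a'=1$) are $0$ and $1$; equivalently, one with $0^{\sim}=1$ and $a^{\sim}=0$ for $a\neq0$. $\mathbb{AOL}$ is the class of antiortholattices. $\mathbf{D}_n$ is the antiortholattice on the $n$-element chain (with its unique order-reversing involution and the trivial Brouwer complement $0^\sim=1$, $a^\sim=0$ for $a\ne0$). $V_{\mathbb{BZL}}(\mathbb{C})$ is the variety generated by $\mathbb{C}$ in the language of BZ-lattices. A cover of $x$ in a lattice is an element $y>x$ with nothing strictly between.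 *)

theory Defs
  imports Main
begin

section \<open>Algebras in the language of BZ-lattices\<close>

text \<open>
  Algebras live on subsets of a type \<open>'a\<close>, which serves as the universe of discourse.
  The values of the operations outside the carrier are irrelevant.
\<close>

record 'a bz_alg =
  carrier :: "'a set"
  meet :: "'a \<Rightarrow> 'a \<Rightarrow> 'a" (infixl "\<sqinter>\<index>" 70)
  join :: "'a \<Rightarrow> 'a \<Rightarrow> 'a" (infixl "\<squnion>\<index>" 65)
  kcomp :: "'a \<Rightarrow> 'a"  \<comment> \<open>the involution, written as a prime\<close>
  bcomp :: "'a \<Rightarrow> 'a"  \<comment> \<open>the Brouwer complement, written as a tilde\<close>
  zero :: 'a ("\<zero>\<index>")
  one :: 'a ("\<one>\<index>")

definition leq :: "'a bz_alg \<Rightarrow> 'a \<Rightarrow> 'a \<Rightarrow> bool" (infix "\<sqsubseteq>\<index>" 50) where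
  "x \<sqsubseteq>\<^bsub>L\<^esub> y \<longleftrightarrow> x \<sqinter>\<^bsub>L\<^esub> y = x"

locale bz_algebra =
  fixes L :: "'a bz_alg" (structure)
  assumes meet_closed: "\<lbrakk>x \<in> carrier L; y \<in> carrier L\<rbrakk> \<Longrightarrow> x \<sqinter> y \<in> carrier L"
    and join_closed: "\<lbrakk>x \<in> carrier L; y \<in> carrier L\<rbrakk> \<Longrightarrow> x \<squnion> y \<in> carrier L"
    and kcomp_closed: "x \<in> carrier L \<Longrightarrow> kcomp L x \<in> carrier L"
    and bcomp_closed: "x \<in> carrier L \<Longrightarrow> bcomp L x \<in> carrier L"
    and zero_closed: "\<zero> \<in> carrier L"
    and one_closed: "\<one> \<in> carrier L"

locale bounded_lattice_algebra = bz_algebra +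
  assumes meet_commute: "\<lbrakk>x \<in> carrier L; y \<in> carrier L\<rbrakk> \<Longrightarrow> x \<sqinter> y = y \<sqinter> x"
    and join_commute: "\<lbrakk>x \<in> carrier L; y \<in> carrier L\<rbrakk> \<Longrightarrow> x \<squnion> y = y \<squnion> x"
    and meet_assoc: "\<lbrakk>x \<in> carrier L; y \<in> carrier L; z \<in> carrier L\<rbrakk>
      \<Longrightarrow> (x \<sqinter> y) \<sqinter> z = x \<sqinter> (y \<sqinter> z)"
    and join_assoc: "\<lbrakk>x \<in> carrier L; y \<in> carrier L; z \<in> carrier L\<rbrakk>
      \<Longrightarrow> (x \<squnion> y) \<squnion> z = x \<squnion> (y \<squnion> z)"
    and meet_absorb: "\<lbrakk>x \<in> carrier L; y \<in> carrier L\<rbrakk> \<Longrightarrow> x \<sqinter> (x \<squnion> y) = x"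
    and join_absorb: "\<lbrakk>x \<in> carrier L; y \<in> carrier L\<rbrakk> \<Longrightarrow> x \<squnion> (x \<sqinter> y) = x"
    and zero_least: "x \<in> carrier L \<Longrightarrow> \<zero> \<sqsubseteq> x"
    and one_greatest: "x \<in> carrier L \<Longrightarrow> x \<sqsubseteq> \<one>"

locale pseudo_kleene_algebra = bounded_lattice_algebra +
  assumes kcomp_antitone:
      "\<lbrakk>x \<in> carrier L; y \<in> carrier L; x \<sqsubseteq> y\<rbrakk> \<Longrightarrow> kcomp L y \<sqsubseteq> kcomp L x"
    and kcomp_involutive: "x \<in> carrier L \<Longrightarrow> kcomp L (kcomp L x) = x"
    and kleene: "\<lbrakk>x \<in> carrier L; y \<in> carrier L\<rbrakk> \<Longrightarrow> x \<sqinter> kcomp L x \<sqsubseteq> y \<squnion> kcomp L y"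

locale bz_lattice = pseudo_kleene_algebra +
  assumes bcomp_antitone:
      "\<lbrakk>x \<in> carrier L; y \<in> carrier L; x \<sqsubseteq> y\<rbrakk> \<Longrightarrow> bcomp L y \<sqsubseteq> bcomp L x"
    and meet_bcomp: "x \<in> carrier L \<Longrightarrow> x \<sqinter> bcomp L x = \<zero>"
    and le_bcomp_bcomp: "x \<in> carrier L \<Longrightarrow> x \<sqsubseteq> bcomp L (bcomp L x)"
    and bcomp_bcomp: "x \<in> carrier L \<Longrightarrow> bcomp L (bcomp L x) = kcomp L (bcomp L x)"

locale pbz_star_lattice = bz_lattice +
  assumes paraorthomodular:
      "\<lbrakk>x \<in> carrier L; y \<in> carrier L; x \<sqsubseteq> y; kcomp L x \<sqinter> y = \<zero>\<rbrakk> \<Longrightarrow> x = y"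
    and star: "x \<in> carrier L \<Longrightarrow> bcomp L (x \<sqinter> kcomp L x) = bcomp L x \<squnion> bcomp L (kcomp L x)"

definition sharp :: "'a bz_alg \<Rightarrow> 'a \<Rightarrow> bool" where
  "sharp L x \<longleftrightarrow> x \<in> carrier L \<and> x \<squnion>\<^bsub>L\<^esub> kcomp L x = \<one>\<^bsub>L\<^esub>"

locale antiortholattice = pbz_star_lattice +
  assumes sharp_trivial: "sharp L x \<Longrightarrow> x = \<zero> \<or> x = \<one>"

definition PBZL_star :: "'a bz_alg set" where
  "PBZL_star = {L. pbz_star_lattice L}"

definition AOL :: "'a bz_alg set" where
  "AOL = {L. antiortholattice L}"

text \<open>The antiortholattice on the chain \<open>0 < 1 < \<dots> < n - 1\<close>, for \<open>n \<ge> 1\<close>.\<close>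

definition D :: "nat \<Rightarrow> nat bz_alg" where
  "D n = \<lparr>carrier = {..<n}, meet = min, join = max,
          kcomp = (\<lambda>x. n - 1 - x), bcomp = (\<lambda>x. if x = 0 then n - 1 else 0),
          zero = 0, one = n - 1\<rparr>"

definition bz_iso :: "'a bz_alg \<Rightarrow> 'b bz_alg \<Rightarrow> bool" where
  "bz_iso A B \<longleftrightarrow> bz_algebra A \<and> bz_algebra B \<and> (\<exists>f. bij_betw f (carrier A) (carrier B)
     \<and> (\<forall>x\<in>carrier A. \<forall>y\<in>carrier A. f (x \<sqinter>\<^bsub>A\<^esub> y) = f x \<sqinter>\<^bsub>B\<^esub> f y)
     \<and> (\<forall>x\<in>carrier A. \<forall>y\<in>carrier A. f (x \<squnion>\<^bsub>A\<^esub> y) = f x \<squnion>\<^bsub>B\<^esub> f y)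
     \<and> (\<forall>x\<in>carrier A. f (kcomp A x) = kcomp B (f x))
     \<and> (\<forall>x\<in>carrier A. f (bcomp A x) = bcomp B (f x))
     \<and> f \<zero>\<^bsub>A\<^esub> = \<zero>\<^bsub>B\<^esub> \<and> f \<one>\<^bsub>A\<^esub> = \<one>\<^bsub>B\<^esub>)"


section \<open>Varieties\<close>

datatype bz_term =
    Var nat
  | Meet bz_term bz_term
  | Join bz_term bz_term
  | KComp bz_term
  | BComp bz_term
  | Zero
  | One

primrec interp :: "'a bz_alg \<Rightarrow> (nat \<Rightarrow> 'a) \<Rightarrow> bz_term \<Rightarrow> 'a" where
  "interp A v (Var i) = v i"
| "interp A v (Meet s t) = interp A v s \<sqinter>\<^bsub>A\<^esub> interp A v t"
| "interp A v (Join s t) = interp A v s \<squnion>\<^bsub>A\<^esub> interp A v t"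
| "interp A v (KComp t) = kcomp A (interp A v t)"
| "interp A v (BComp t) = bcomp A (interp A v t)"
| "interp A v Zero = \<zero>\<^bsub>A\<^esub>"
| "interp A v One = \<one>\<^bsub>A\<^esub>"

definition satisfies :: "'a bz_alg \<Rightarrow> bz_term \<times> bz_term \<Rightarrow> bool" where
  "satisfies A e \<longleftrightarrow>
     (\<forall>v. range v \<subseteq> carrier A \<longrightarrow> interp A v (fst e) = interp A v (snd e))"

text \<open>
  Varieties are equational classes. Closure under homomorphic images, subalgebras and products
  would not be an adequate definition here, since an infinite product of algebras with carriers
  in \<open>'a\<close> need not fit into \<open>'a\<close>. When \<open>'a\<close> is infinite it contains a copy of every countable
  algebra, in particular of every free algebra on countably many generators, so that distinct
  varieties have distinct traces on \<open>'a\<close> and the inclusion order between them is preserved and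
  reflected.
\<close>

definition variety :: "'a bz_alg set \<Rightarrow> bool" where
  "variety K \<longleftrightarrow> (\<exists>E. K = {A. bz_algebra A \<and> (\<forall>e\<in>E. satisfies A e)})"

definition V_BZL :: "'a bz_alg set \<Rightarrow> 'a bz_alg set" where
  "V_BZL K = \<Inter>{W. variety W \<and> K \<subseteq> W}"

definition subvarieties :: "'a bz_alg set \<Rightarrow> 'a bz_alg set set" where
  "subvarieties K = {W. variety W \<and> W \<subseteq> K}"

definition cover_in :: "'b::order set \<Rightarrow> 'b \<Rightarrow> 'b \<Rightarrow> bool" where
  "cover_in S x y \<longleftrightarrow> x \<in> S \<and> y \<in> S \<and> x < y \<and> \<not> (\<exists>z\<in>S. x < z \<and> z < y)"

end

theory Submission
  imports Defs
begin

text \<open>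
  In an antiortholattice every Brouwer complement is \<open>\<zero>\<close> or \<open>\<one>\<close>, so meeting with
  \<open>bcomp L z\<close> either kills everything or changes nothing. Hence, in every member of
  \<open>V_BZL AOL\<close>, the map \<open>x \<mapsto> x \<sqinter> bcomp L z\<close> is a homomorphism onto the interval below
  \<open>bcomp L z\<close>, and \<open>x\<close> is recovered from its parts below \<open>bcomp L z\<close> and
  \<open>bcomp L (bcomp L z)\<close>, because all of this can be said by identities
  (\<open>V_AOL_central_pbz\<close>). The same identities include an equational form of
  paraorthomodularity, so that \<open>V_BZL AOL\<close> consists of PBZ*-lattices.

  The varieties generated by the two chains are separated by the flat identity
  \<open>(x \<squnion> x') \<sqinter> (x \<sqinter> x')\<^sup>~\<^sup>~ = x \<sqinter> x'\<close>. In an antiortholattice it says that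
  \<open>x \<sqinter> x' \<noteq> \<zero>\<close> forces \<open>x = x'\<close>; it holds in \<open>D 3\<close> and fails in \<open>D 4\<close>. The theorem comes
  from a dichotomy for an algebra \<open>L\<close> in \<open>V_BZL AOL\<close>.

  If \<open>L\<close> violates the flat identity at \<open>a\<close>, put \<open>b = a \<sqinter> a'\<close> and let \<open>s\<close> be its double
  Brouwer complement. In the interval below \<open>s\<close> the elements \<open>\<zero> < b < b' \<sqinter> s < s\<close> form a
  subalgebra isomorphic to \<open>D 4\<close>, so \<open>D 4\<close> is a quotient of a subalgebra of \<open>L\<close> and satisfies
  every identity of \<open>L\<close> (\<open>satisfies_D4_if_not_flat\<close>).

  If \<open>L\<close> satisfies the flat identity, evaluate two terms at finitely many elements. Splitting
  \<open>L\<close> repeatedly along the Brouwer complements of these elements and of their involutes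
  reduces to intervals where each of them is the bottom, the top, or a dense fixed point of the
  involution. By the Kleene law there is only one such fixed point, so on each interval the
  computation takes place in a copy of \<open>D 3\<close>, or of its subalgebra \<open>{0, 2}\<close>. Hence \<open>L\<close>
  satisfies every identity of \<open>D 3\<close> (\<open>satisfies_if_flat\<close>).

  Consequently every variety \<open>W \<subseteq> V_BZL AOL\<close> strictly above \<open>V_BZL {D3}\<close> contains \<open>D4\<close>,
  whereas \<open>V_BZL {D4}\<close> is itself strictly above \<open>V_BZL {D3}\<close>, because identifying the two
  middle elements of \<open>D 4\<close> gives \<open>D 3\<close>. So \<open>V_BZL {D4}\<close> is the least such variety, which makes
  it a cover, and the only one.
\<close>

section \<open>Order-theoretic preliminaries\<close>

context bounded_lattice_algebra
begin

lemma meet_idem: "x \<in> carrier L \<Longrightarrow> x \<sqinter> x = x"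
  by (metis join_absorb meet_absorb meet_closed)

lemma leq_refl: "x \<in> carrier L \<Longrightarrow> x \<sqsubseteq> x"
  by (simp add: leq_def meet_idem)

lemma leq_antisym: "\<lbrakk>x \<in> carrier L; y \<in> carrier L; x \<sqsubseteq> y; y \<sqsubseteq> x\<rbrakk> \<Longrightarrow> x = y"
  unfolding leq_def by (metis meet_commute)

lemma leq_trans:
  "\<lbrakk>x \<in> carrier L; y \<in> carrier L; z \<in> carrier L; x \<sqsubseteq> y; y \<sqsubseteq> z\<rbrakk> \<Longrightarrow> x \<sqsubseteq> z"
  unfolding leq_def by (metis meet_assoc)

lemma meet_lower1: "\<lbrakk>x \<in> carrier L; y \<in> carrier L\<rbrakk> \<Longrightarrow> x \<sqinter> y \<sqsubseteq> x"
  unfolding leq_def by (metis meet_assoc meet_commute meet_idem)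

lemma meet_lower2: "\<lbrakk>x \<in> carrier L; y \<in> carrier L\<rbrakk> \<Longrightarrow> x \<sqinter> y \<sqsubseteq> y"
  unfolding leq_def by (metis meet_assoc meet_idem)

lemma meet_greatest:
  "\<lbrakk>x \<in> carrier L; y \<in> carrier L; z \<in> carrier L; z \<sqsubseteq> x; z \<sqsubseteq> y\<rbrakk> \<Longrightarrow> z \<sqsubseteq> x \<sqinter> y"
  unfolding leq_def by (metis meet_assoc)

lemma leq_iff_join: "\<lbrakk>x \<in> carrier L; y \<in> carrier L\<rbrakk> \<Longrightarrow> x \<sqsubseteq> y \<longleftrightarrow> x \<squnion> y = y"
  unfolding leq_def by (metis join_absorb join_commute meet_absorb meet_commute)

lemma join_upper1: "\<lbrakk>x \<in> carrier L; y \<in> carrier L\<rbrakk> \<Longrightarrow> x \<sqsubseteq> x \<squnion> y"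
  by (simp add: leq_def meet_absorb)

lemma join_upper2: "\<lbrakk>x \<in> carrier L; y \<in> carrier L\<rbrakk> \<Longrightarrow> y \<sqsubseteq> x \<squnion> y"
  by (metis join_commute join_upper1)

lemma join_least:
  "\<lbrakk>x \<in> carrier L; y \<in> carrier L; z \<in> carrier L; x \<sqsubseteq> z; y \<sqsubseteq> z\<rbrakk> \<Longrightarrow> x \<squnion> y \<sqsubseteq> z"
  using leq_iff_join join_assoc join_closed by metis

lemma meet_zero: "x \<in> carrier L \<Longrightarrow> x \<sqinter> \<zero> = \<zero>" "x \<in> carrier L \<Longrightarrow> \<zero> \<sqinter> x = \<zero>"
  using zero_least zero_closed meet_commute unfolding leq_def by metis+

lemma meet_one: "x \<in> carrier L \<Longrightarrow> x \<sqinter> \<one> = x" "x \<in> carrier L \<Longrightarrow> \<one> \<sqinter> x = x"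
  using one_greatest one_closed meet_commute unfolding leq_def by metis+

lemma join_zero: "x \<in> carrier L \<Longrightarrow> x \<squnion> \<zero> = x" "x \<in> carrier L \<Longrightarrow> \<zero> \<squnion> x = x"
  using zero_least zero_closed join_commute leq_iff_join by metis+

lemma meet_meet_distrib:
  "\<lbrakk>x \<in> carrier L; y \<in> carrier L; s \<in> carrier L\<rbrakk> \<Longrightarrow> (x \<sqinter> y) \<sqinter> s = (x \<sqinter> s) \<sqinter> (y \<sqinter> s)"
  by (metis meet_assoc meet_closed meet_commute meet_idem)

end

context pseudo_kleene_algebra
begin

lemma kcomp_zero: "kcomp L \<zero> = \<one>"
proof (rule leq_antisym)
  show "\<one> \<sqsubseteq> kcomp L \<zero>"
    using kcomp_antitone[of \<zero> "kcomp L \<one>"]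
    by (simp add: zero_closed one_closed kcomp_closed zero_least kcomp_involutive)
qed (simp_all add: zero_closed one_closed kcomp_closed one_greatest)

lemma kcomp_one: "kcomp L \<one> = \<zero>"
  by (metis kcomp_zero kcomp_involutive zero_closed)

lemma kcomp_meet:
  assumes x: "x \<in> carrier L" and y: "y \<in> carrier L"
  shows "kcomp L (x \<sqinter> y) = kcomp L x \<squnion> kcomp L y"
proof (rule leq_antisym)
  let ?j = "kcomp L x \<squnion> kcomp L y"
  note cl = x y kcomp_closed meet_closed join_closed
  have "kcomp L ?j \<sqsubseteq> kcomp L (kcomp L x)" "kcomp L ?j \<sqsubseteq> kcomp L (kcomp L y)"
    using cl by (simp_all add: kcomp_antitone join_upper1 join_upper2)
  then have "kcomp L ?j \<sqsubseteq> x" "kcomp L ?j \<sqsubseteq> y"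
    using cl by (simp_all add: kcomp_involutive)
  then have "kcomp L ?j \<sqsubseteq> x \<sqinter> y"
    using cl by (simp add: meet_greatest)
  then show "kcomp L (x \<sqinter> y) \<sqsubseteq> ?j"
    using cl kcomp_antitone[of "kcomp L ?j" "x \<sqinter> y"] by (simp add: kcomp_involutive)
  show "?j \<sqsubseteq> kcomp L (x \<sqinter> y)"
    using cl by (simp add: join_least kcomp_antitone meet_lower1 meet_lower2)
qed (use x y kcomp_closed meet_closed join_closed in simp_all)

end

context bz_lattice
begin

lemma bcomp_one: "bcomp L \<one> = \<zero>"
  by (metis bcomp_closed meet_bcomp meet_one(2) one_closed)

lemma bcomp_zero: "bcomp L \<zero> = \<one>"
  by (metis bcomp_bcomp bcomp_one kcomp_zero one_closed)

lemma bcomp_join: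
  assumes x: "x \<in> carrier L" and y: "y \<in> carrier L"
  shows "bcomp L (x \<squnion> y) = bcomp L x \<sqinter> bcomp L y"
proof (rule leq_antisym)
  let ?m = "bcomp L x \<sqinter> bcomp L y"
  note cl = x y bcomp_closed meet_closed join_closed
  show "bcomp L (x \<squnion> y) \<sqsubseteq> ?m"
    using cl by (simp add: meet_greatest bcomp_antitone join_upper1 join_upper2)
  have "bcomp L (bcomp L x) \<sqsubseteq> bcomp L ?m" "bcomp L (bcomp L y) \<sqsubseteq> bcomp L ?m"
    using cl by (simp_all add: bcomp_antitone meet_lower1 meet_lower2)
  then have "x \<sqsubseteq> bcomp L ?m" "y \<sqsubseteq> bcomp L ?m"
    using cl leq_trans[OF _ _ _ le_bcomp_bcomp] by simp_all
  then have "x \<squnion> y \<sqsubseteq> bcomp L ?m"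
    using cl by (simp add: join_least)
  then have "bcomp L (bcomp L ?m) \<sqsubseteq> bcomp L (x \<squnion> y)"
    using cl by (simp add: bcomp_antitone)
  then show "?m \<sqsubseteq> bcomp L (x \<squnion> y)"
    using cl leq_trans[OF _ _ _ le_bcomp_bcomp] by simp
qed (use x y bcomp_closed meet_closed join_closed in simp_all)

text \<open>
  This is what forces Brouwer complements in an antiortholattice to be trivial.
\<close>

lemma bcomp_sharp:
  assumes "x \<in> carrier L"
  shows "sharp L (bcomp L x)"
proof -
  note cl = assms bcomp_closed
  have "bcomp L x \<squnion> kcomp L (bcomp L x) = kcomp L (bcomp L (bcomp L x) \<sqinter> bcomp L x)"
    using cl by (simp add: kcomp_meet kcomp_closed kcomp_involutive bcomp_bcomp[of x])
  also have "\<dots> = \<one>"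
    using cl meet_bcomp[of "bcomp L x"] by (simp add: meet_commute kcomp_zero)
  finally show ?thesis using cl by (simp add: sharp_def)
qed

end


section \<open>Central Brouwer complements\<close>

text \<open>
  The added axioms say that meeting with a Brouwer complement is a homomorphism onto the interval
  below it, and that complementary Brouwer complements decompose every element. Compatibility with
  \<open>\<sqinter>\<close> holds in any lattice. The locale is the equational shadow of antiortholattices:
  it is defined by identities and is strong enough for the whole argument.
\<close>

locale central_pbz = pbz_star_lattice +
  assumes central_join:
      "\<lbrakk>x \<in> carrier L; y \<in> carrier L; z \<in> carrier L\<rbrakk>
        \<Longrightarrow> (x \<squnion> y) \<sqinter> bcomp L z = (x \<sqinter> bcomp L z) \<squnion> (y \<sqinter> bcomp L z)"
    and central_kcomp:
      "\<lbrakk>x \<in> carrier L; z \<in> carrier L\<rbrakk>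
        \<Longrightarrow> kcomp L x \<sqinter> bcomp L z = kcomp L (x \<sqinter> bcomp L z) \<sqinter> bcomp L z"
    and central_bcomp:
      "\<lbrakk>x \<in> carrier L; z \<in> carrier L\<rbrakk>
        \<Longrightarrow> bcomp L x \<sqinter> bcomp L z = bcomp L (x \<sqinter> bcomp L z) \<sqinter> bcomp L z"
    and central_split:
      "\<lbrakk>x \<in> carrier L; z \<in> carrier L\<rbrakk>
        \<Longrightarrow> (x \<sqinter> bcomp L z) \<squnion> (x \<sqinter> bcomp L (bcomp L z)) = x"

context antiortholattice
begin

lemma bcomp_trivial: "z \<in> carrier L \<Longrightarrow> bcomp L z = \<zero> \<or> bcomp L z = \<one>"
  using sharp_trivial bcomp_sharp by blast

end

sublocale antiortholattice \<subseteq> central_pbz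
proof unfold_locales
  fix x y z assume cl: "x \<in> carrier L" "y \<in> carrier L" "z \<in> carrier L"
  show "(x \<squnion> y) \<sqinter> bcomp L z = (x \<sqinter> bcomp L z) \<squnion> (y \<sqinter> bcomp L z)"
    using bcomp_trivial[OF cl(3)] cl
    by (auto simp: meet_zero meet_one join_zero join_closed zero_closed)
next
  fix x z assume cl: "x \<in> carrier L" "z \<in> carrier L"
  note facts = cl meet_zero meet_one join_zero kcomp_closed bcomp_closed zero_closed one_closed
    bcomp_zero bcomp_one
  show "kcomp L x \<sqinter> bcomp L z = kcomp L (x \<sqinter> bcomp L z) \<sqinter> bcomp L z"
    using bcomp_trivial[OF cl(2)] by (auto simp: facts)
  show "bcomp L x \<sqinter> bcomp L z = bcomp L (x \<sqinter> bcomp L z) \<sqinter> bcomp L z"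
    using bcomp_trivial[OF cl(2)] by (auto simp: facts)
  show "(x \<sqinter> bcomp L z) \<squnion> (x \<sqinter> bcomp L (bcomp L z)) = x"
    using bcomp_trivial[OF cl(2)] by (auto simp: facts)
qed


section \<open>Equational classes\<close>

text \<open>
  If every member of \<open>K\<close> is an algebra, the variety of all algebras contains \<open>K\<close>, so the
  intersection in the definition of \<open>V_BZL\<close> is over a nonempty family and is itself a variety.
\<close>

lemma V_BZL_eq:
  assumes "\<And>B. B \<in> K \<Longrightarrow> bz_algebra B"
  shows "V_BZL K = {A. bz_algebra A \<and> (\<forall>e. (\<forall>B\<in>K. satisfies B e) \<longrightarrow> satisfies A e)}" (is "_ = ?R")
proof
  have "?R = {A. bz_algebra A \<and> (\<forall>e\<in>{e. \<forall>B\<in>K. satisfies B e}. satisfies A e)}" by simp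
  then have "variety ?R" unfolding variety_def by blast
  moreover have "K \<subseteq> ?R" using assms by auto
  ultimately show "V_BZL K \<subseteq> ?R" unfolding V_BZL_def by blast
  show "?R \<subseteq> V_BZL K" unfolding V_BZL_def variety_def by blast
qed

lemma variety_V_BZL:
  assumes "\<And>B. B \<in> K \<Longrightarrow> bz_algebra B"
  shows "variety (V_BZL K)"
proof -
  have "V_BZL K = {A. bz_algebra A \<and> (\<forall>e\<in>{e. \<forall>B\<in>K. satisfies B e}. satisfies A e)}"
    using V_BZL_eq[OF assms] by simp
  then show ?thesis unfolding variety_def by blast
qed

lemma V_BZL_least: "variety W \<Longrightarrow> K \<subseteq> W \<Longrightarrow> V_BZL K \<subseteq> W"
  unfolding V_BZL_def by blast

lemma V_BZL_superset: "K \<subseteq> V_BZL K"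
  unfolding V_BZL_def by blast

lemma antiortholattice_bz_algebra: "L \<in> AOL \<Longrightarrow> bz_algebra L"
  unfolding AOL_def antiortholattice_def pbz_star_lattice_def bz_lattice_def
    pseudo_kleene_algebra_def bounded_lattice_algebra_def by simp

definition triple_val :: "'a \<Rightarrow> 'a \<Rightarrow> 'a \<Rightarrow> nat \<Rightarrow> 'a" where
  "triple_val x y z i = (if i = 0 then x else if i = 1 then y else z)"

text \<open>
  The premise \<open>x \<sqsubseteq> y\<close> of the antitonicity axioms disappears by writing \<open>x \<sqinter> y\<close> for \<open>x\<close>. The
  one entry that is not a direct transcription of an axiom replaces paraorthomodularity: the factor
  \<open>((x \<sqinter> y)' \<sqinter> y)\<^sup>~\<close> is \<open>\<one>\<close> as soon as \<open>(x \<sqinter> y)' \<sqinter> y = \<zero>\<close>.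
\<close>

definition central_pbz_identities :: "(bz_term \<times> bz_term) set" where
  "central_pbz_identities = (let x = Var 0; y = Var 1; z = Var 2; s = BComp z in
    {(Meet x y, Meet y x),
     (Join x y, Join y x),
     (Meet (Meet x y) z, Meet x (Meet y z)),
     (Join (Join x y) z, Join x (Join y z)),
     (Meet x (Join x y), x),
     (Join x (Meet x y), x),
     (Meet Zero x, Zero),
     (Meet x One, x),
     (Meet (KComp y) (KComp (Meet x y)), KComp y),
     (KComp (KComp x), x),
     (Meet (Meet x (KComp x)) (Join y (KComp y)), Meet x (KComp x)),
     (Meet (BComp y) (BComp (Meet x y)), BComp y),
     (Meet x (BComp x), Zero),
     (Meet x (BComp (BComp x)), x),
     (BComp (BComp x), KComp (BComp x)),
     (Meet (Meet x y) (BComp (Meet (KComp (Meet x y)) y)),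
      Meet y (BComp (Meet (KComp (Meet x y)) y))),
     (BComp (Meet x (KComp x)), Join (BComp x) (BComp (KComp x))),
     (Meet (Join x y) s, Join (Meet x s) (Meet y s)),
     (Meet (KComp x) s, Meet (KComp (Meet x s)) s),
     (Meet (BComp x) s, Meet (BComp (Meet x s)) s),
     (Join (Meet x s) (Meet x (BComp s)), x)})"

context central_pbz
begin

text \<open>
  Relativising to the interval below the Brouwer complement of \<open>(x \<sqinter> y)' \<sqinter> y\<close> makes that
  element vanish, so paraorthomodularity applies there.
\<close>

lemma paraorthomodular_identity:
  assumes x: "x \<in> carrier L" and y: "y \<in> carrier L"
  shows "(x \<sqinter> y) \<sqinter> bcomp L (kcomp L (x \<sqinter> y) \<sqinter> y) = y \<sqinter> bcomp L (kcomp L (x \<sqinter> y) \<sqinter> y)"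
    (is "?u \<sqinter> ?s = y \<sqinter> ?s")
proof (rule paraorthomodular)
  note cl = x y meet_closed kcomp_closed bcomp_closed
  show "?u \<sqinter> ?s \<in> carrier L" "y \<sqinter> ?s \<in> carrier L"
    using cl by simp_all
  have "?u \<sqinter> ?s \<sqsubseteq> ?u" "?u \<sqinter> ?s \<sqsubseteq> ?s" "?u \<sqsubseteq> y"
    using cl by (simp_all add: meet_lower1 meet_lower2)
  then show "?u \<sqinter> ?s \<sqsubseteq> y \<sqinter> ?s"
    using cl leq_trans[of "?u \<sqinter> ?s" ?u y] by (simp add: meet_greatest)
  have u: "?u \<in> carrier L" and s: "?s \<in> carrier L" and ku: "kcomp L ?u \<in> carrier L"
    and k: "kcomp L (?u \<sqinter> ?s) \<in> carrier L"
    using cl by simp_all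
  have "kcomp L (?u \<sqinter> ?s) \<sqinter> (y \<sqinter> ?s) = kcomp L (?u \<sqinter> ?s) \<sqinter> ?s \<sqinter> y"
    unfolding meet_assoc[OF k s y] meet_commute[OF s y] ..
  also have "kcomp L (?u \<sqinter> ?s) \<sqinter> ?s = kcomp L ?u \<sqinter> ?s"
    by (rule central_kcomp[symmetric, OF u meet_closed[OF ku y]])
  also have "kcomp L ?u \<sqinter> ?s \<sqinter> y = kcomp L ?u \<sqinter> y \<sqinter> ?s"
    unfolding meet_assoc[OF ku s y] meet_commute[OF s y] meet_assoc[OF ku y s] ..
  also have "\<dots> = \<zero>"
    by (rule meet_bcomp[OF meet_closed[OF ku y]])
  finally show "kcomp L (?u \<sqinter> ?s) \<sqinter> (y \<sqinter> ?s) = \<zero>" .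
qed

lemma satisfies_central_pbz_identities:
  assumes "e \<in> central_pbz_identities"
  shows "satisfies L e"
proof -
  have "\<forall>e\<in>central_pbz_identities. interp L v (fst e) = interp L v (snd e)"
    if v: "range v \<subseteq> carrier L" for v
  proof -
    obtain x y z where xyz: "v 0 = x" "v 1 = y" "v 2 = z" by simp
    have cl: "x \<in> carrier L" "y \<in> carrier L" "z \<in> carrier L"
      using v xyz by auto
    have order: "kcomp L y \<sqinter> kcomp L (x \<sqinter> y) = kcomp L y"
      "x \<sqinter> kcomp L x \<sqinter> (y \<squnion> kcomp L y) = x \<sqinter> kcomp L x"
      "bcomp L y \<sqinter> bcomp L (x \<sqinter> y) = bcomp L y"
      "x \<sqinter> bcomp L (bcomp L x) = x"
      "\<zero> \<sqinter> x = \<zero>" "x \<sqinter> \<one> = x"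
      using cl kcomp_antitone[OF _ _ meet_lower2, of x y] kleene[of x y]
        bcomp_antitone[OF _ _ meet_lower2, of x y]
        le_bcomp_bcomp[of x] zero_least[of x] one_greatest[of x]
      by (simp_all add: meet_closed leq_def)
    show ?thesis
      unfolding central_pbz_identities_def Let_def ball_simps fst_conv snd_conv interp.simps xyz
      by (intro conjI TrueI order meet_commute join_commute meet_assoc join_assoc meet_absorb join_absorb
          kcomp_involutive meet_bcomp bcomp_bcomp paraorthomodular_identity star
          central_join central_kcomp central_bcomp central_split cl)
  qed
  then show ?thesis using assms by (simp add: satisfies_def)
qed

end

lemma central_pbz_iff_identities:
  "central_pbz A \<longleftrightarrow> bz_algebra A \<and> (\<forall>e\<in>central_pbz_identities. satisfies A e)"
proof
  assume "central_pbz A"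
  then interpret central_pbz A .
  show "bz_algebra A \<and> (\<forall>e\<in>central_pbz_identities. satisfies A e)"
    using bz_algebra_axioms satisfies_central_pbz_identities by blast
next
  assume A: "bz_algebra A \<and> (\<forall>e\<in>central_pbz_identities. satisfies A e)"
  then interpret bz_algebra A by simp
  have "\<forall>e\<in>central_pbz_identities.
      interp A (triple_val x y z) (fst e) = interp A (triple_val x y z) (snd e)"
    if "x \<in> carrier A" "y \<in> carrier A" "z \<in> carrier A" for x y z
    using A that by (auto simp: satisfies_def triple_val_def image_subset_iff)
  note ids = this[unfolded central_pbz_identities_def Let_def, simplified,
      unfolded triple_val_def, simplified]
  interpret bounded_lattice_algebra A
    by unfold_locales (use ids in \<open>simp_all add: leq_def\<close>)
  interpret pseudo_kleene_algebra A
  proof unfold_locales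
    fix x y assume "x \<in> carrier A" "y \<in> carrier A" "x \<sqsubseteq>\<^bsub>A\<^esub> y"
    moreover from this have "kcomp A y \<sqinter>\<^bsub>A\<^esub> kcomp A (x \<sqinter>\<^bsub>A\<^esub> y) = kcomp A y"
      using ids[of x y x] by blast
    ultimately show "kcomp A y \<sqsubseteq>\<^bsub>A\<^esub> kcomp A x" by (simp only: leq_def)
  qed (use ids in \<open>simp_all add: leq_def\<close>)
  interpret bz_lattice A
  proof unfold_locales
    fix x y assume "x \<in> carrier A" "y \<in> carrier A" "x \<sqsubseteq>\<^bsub>A\<^esub> y"
    moreover from this have "bcomp A y \<sqinter>\<^bsub>A\<^esub> bcomp A (x \<sqinter>\<^bsub>A\<^esub> y) = bcomp A y"
      using ids[of x y x] by blast
    ultimately show "bcomp A y \<sqsubseteq>\<^bsub>A\<^esub> bcomp A x" by (simp only: leq_def)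
  next
    fix x assume x: "x \<in> carrier A"
    show "x \<sqsubseteq>\<^bsub>A\<^esub> bcomp A (bcomp A x)"
      unfolding leq_def using ids[OF x x x] by blast
    show "bcomp A (bcomp A x) = kcomp A (bcomp A x)" "x \<sqinter>\<^bsub>A\<^esub> bcomp A x = \<zero>\<^bsub>A\<^esub>"
      using ids[OF x x x] by blast+
  qed
  show "central_pbz A"
  proof unfold_locales
    fix x y assume xy: "x \<in> carrier A" "y \<in> carrier A" "x \<sqsubseteq>\<^bsub>A\<^esub> y" "kcomp A x \<sqinter>\<^bsub>A\<^esub> y = \<zero>\<^bsub>A\<^esub>"
    have "x \<sqinter>\<^bsub>A\<^esub> y \<sqinter>\<^bsub>A\<^esub> bcomp A (kcomp A (x \<sqinter>\<^bsub>A\<^esub> y) \<sqinter>\<^bsub>A\<^esub> y)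
        = y \<sqinter>\<^bsub>A\<^esub> bcomp A (kcomp A (x \<sqinter>\<^bsub>A\<^esub> y) \<sqinter>\<^bsub>A\<^esub> y)"
      using ids[OF xy(1,2,2)] by blast
    then show "x = y" using xy by (simp add: leq_def bcomp_zero meet_one)
  next
    fix x z assume xz: "x \<in> carrier A" "z \<in> carrier A"
    show "kcomp A x \<sqinter>\<^bsub>A\<^esub> bcomp A z = kcomp A (x \<sqinter>\<^bsub>A\<^esub> bcomp A z) \<sqinter>\<^bsub>A\<^esub> bcomp A z"
      using ids[OF xz(1,1,2)] by blast
    show "bcomp A x \<sqinter>\<^bsub>A\<^esub> bcomp A z = bcomp A (x \<sqinter>\<^bsub>A\<^esub> bcomp A z) \<sqinter>\<^bsub>A\<^esub> bcomp A z"
      using ids[OF xz(1,1,2)] by blast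
    show "(x \<sqinter>\<^bsub>A\<^esub> bcomp A z) \<squnion>\<^bsub>A\<^esub> (x \<sqinter>\<^bsub>A\<^esub> bcomp A (bcomp A z)) = x"
      using ids[OF xz(1,1,2)] by blast
    show "bcomp A (x \<sqinter>\<^bsub>A\<^esub> kcomp A x) = bcomp A x \<squnion>\<^bsub>A\<^esub> bcomp A (kcomp A x)"
      using ids[OF xz(1,1,2)] by blast
  next
    fix x y z assume xyz: "x \<in> carrier A" "y \<in> carrier A" "z \<in> carrier A"
    show "(x \<squnion>\<^bsub>A\<^esub> y) \<sqinter>\<^bsub>A\<^esub> bcomp A z = (x \<sqinter>\<^bsub>A\<^esub> bcomp A z) \<squnion>\<^bsub>A\<^esub> (y \<sqinter>\<^bsub>A\<^esub> bcomp A z)"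
      using ids[OF xyz] by blast
  qed
qed

lemma V_AOL_central_pbz:
  fixes A :: "'a bz_alg"
  assumes "A \<in> V_BZL AOL"
  shows "central_pbz A"
proof -
  have "variety {A :: 'a bz_alg. central_pbz A}"
    unfolding variety_def central_pbz_iff_identities by blast
  moreover have "AOL \<subseteq> {A :: 'a bz_alg. central_pbz A}"
  proof
    fix L :: "'a bz_alg" assume "L \<in> AOL"
    then interpret antiortholattice L by (simp add: AOL_def)
    show "L \<in> {A. central_pbz A}" using central_pbz_axioms by simp
  qed
  ultimately show ?thesis using assms V_BZL_least by blast
qed


section \<open>Compatible relations\<close>

primrec term_vars :: "bz_term \<Rightarrow> nat set" where
  "term_vars (Var i) = {i}"
| "term_vars (Meet s t) = term_vars s \<union> term_vars t"
| "term_vars (Join s t) = term_vars s \<union> term_vars t"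
| "term_vars (KComp t) = term_vars t"
| "term_vars (BComp t) = term_vars t"
| "term_vars Zero = {}"
| "term_vars One = {}"

lemma finite_term_vars: "finite (term_vars t)"
  by (induction t) auto

lemma (in bz_algebra) interp_closed: "range v \<subseteq> carrier L \<Longrightarrow> interp L v t \<in> carrier L"
  by (induction t)
    (auto simp: meet_closed join_closed kcomp_closed bcomp_closed zero_closed one_closed)

text \<open>
  Between elements of the carriers, a compatible relation is a subalgebra of the product. Working with relations
  instead of homomorphisms gives subalgebras, quotients and isomorphisms one common treatment.
\<close>

definition compatible :: "'a bz_alg \<Rightarrow> 'b bz_alg \<Rightarrow> ('a \<Rightarrow> 'b \<Rightarrow> bool) \<Rightarrow> bool" where
  "compatible A B R \<longleftrightarrow>
     R \<zero>\<^bsub>A\<^esub> \<zero>\<^bsub>B\<^esub> \<and> R \<one>\<^bsub>A\<^esub> \<one>\<^bsub>B\<^esub>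
     \<and> (\<forall>a b c d. R a c \<longrightarrow> R b d \<longrightarrow>
          R (a \<sqinter>\<^bsub>A\<^esub> b) (c \<sqinter>\<^bsub>B\<^esub> d) \<and> R (a \<squnion>\<^bsub>A\<^esub> b) (c \<squnion>\<^bsub>B\<^esub> d))
     \<and> (\<forall>a c. R a c \<longrightarrow> R (kcomp A a) (kcomp B c) \<and> R (bcomp A a) (bcomp B c))"

lemma compatible_interp:
  assumes "compatible A B R" and "\<And>i. i \<in> term_vars t \<Longrightarrow> R (v i) (u i)"
  shows "R (interp A v t) (interp B u t)"
  using assms(2) by (induction t) (use assms(1) in \<open>simp_all add: compatible_def\<close>)

text \<open>
  A compatible relation that is total and single-valued towards \<open>B\<close> is a homomorphism from a
  subalgebra of \<open>A\<close> onto \<open>B\<close>, and identities pass to quotients of subalgebras.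
\<close>

lemma satisfies_compatible:
  fixes A :: "'a bz_alg" and B :: "'b bz_alg"
  assumes R: "compatible A B R"
    and total: "\<And>b. b \<in> carrier B \<Longrightarrow> \<exists>a\<in>carrier A. R a b"
    and unique: "\<And>a b c. R a b \<Longrightarrow> R a c \<Longrightarrow> b = c"
    and A: "satisfies A e"
  shows "satisfies B e"
  unfolding satisfies_def
proof (intro allI impI)
  fix u :: "nat \<Rightarrow> 'b"
  assume "range u \<subseteq> carrier B"
  then have "\<forall>i. \<exists>a\<in>carrier A. R a (u i)"
    using total by blast
  then obtain v :: "nat \<Rightarrow> 'a" where v: "\<And>i. v i \<in> carrier A" "\<And>i. R (v i) (u i)"
    by metis
  then have "interp A v (fst e) = interp A v (snd e)"
    using A by (auto simp: satisfies_def)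
  then show "interp B u (fst e) = interp B u (snd e)"
    using compatible_interp[OF R, of _ v u] v(2) unique by metis
qed

lemma bz_iso_satisfies:
  assumes "bz_iso A B"
  shows "satisfies A e \<longleftrightarrow> satisfies B e"
proof -
  obtain f where A: "bz_algebra A" and bij: "bij_betw f (carrier A) (carrier B)"
    and f: "\<forall>x\<in>carrier A. \<forall>y\<in>carrier A. f (x \<sqinter>\<^bsub>A\<^esub> y) = f x \<sqinter>\<^bsub>B\<^esub> f y"
      "\<forall>x\<in>carrier A. \<forall>y\<in>carrier A. f (x \<squnion>\<^bsub>A\<^esub> y) = f x \<squnion>\<^bsub>B\<^esub> f y"
      "\<forall>x\<in>carrier A. f (kcomp A x) = kcomp B (f x)"
      "\<forall>x\<in>carrier A. f (bcomp A x) = bcomp B (f x)"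
      "f \<zero>\<^bsub>A\<^esub> = \<zero>\<^bsub>B\<^esub>" "f \<one>\<^bsub>A\<^esub> = \<one>\<^bsub>B\<^esub>"
    using assms unfolding bz_iso_def by blast
  interpret bz_algebra A by (rule A)
  let ?R = "\<lambda>a b. a \<in> carrier A \<and> b = f a"
  have *: "compatible A B ?R" "compatible B A (\<lambda>b a. ?R a b)"
    unfolding compatible_def
    by (auto simp: f meet_closed join_closed kcomp_closed bcomp_closed zero_closed one_closed)
  show ?thesis
  proof
    show "satisfies B e" if "satisfies A e"
      by (rule satisfies_compatible[OF *(1) _ _ that]) (use bij in \<open>auto simp: bij_betw_def\<close>)
    show "satisfies A e" if "satisfies B e"
      by (rule satisfies_compatible[OF *(2) _ _ that])
        (use bij in \<open>auto simp: bij_betw_def inj_on_def\<close>)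
  qed
qed

section \<open>Chains\<close>

lemma D_simps [simp]:
  "carrier (D n) = {..<n}" "meet (D n) = min" "join (D n) = max"
  "kcomp (D n) x = n - 1 - x" "bcomp (D n) x = (if x = 0 then n - 1 else 0)"
  "zero (D n) = 0" "one (D n) = n - 1"
  by (simp_all add: D_def)

lemma D_antiortholattice:
  assumes "n > 0"
  shows "antiortholattice (D n)"
  by unfold_locales (use assms in \<open>auto simp: leq_def sharp_def min_def max_def split: if_splits\<close>)

text \<open>
  All axioms but the triviality of sharp elements follow from identities, which an isomorphism
  preserves.
\<close>

lemma antiortholattice_iso:
  assumes iso: "bz_iso A B" and B: "antiortholattice B"
  shows "antiortholattice A"
proof -
  obtain f where A: "bz_algebra A" and bij: "bij_betw f (carrier A) (carrier B)"
    and f: "\<forall>x\<in>carrier A. \<forall>y\<in>carrier A. f (x \<sqinter>\<^bsub>A\<^esub> y) = f x \<sqinter>\<^bsub>B\<^esub> f y"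
      "\<forall>x\<in>carrier A. \<forall>y\<in>carrier A. f (x \<squnion>\<^bsub>A\<^esub> y) = f x \<squnion>\<^bsub>B\<^esub> f y"
      "\<forall>x\<in>carrier A. f (kcomp A x) = kcomp B (f x)"
      "\<forall>x\<in>carrier A. f (bcomp A x) = bcomp B (f x)"
      "f \<zero>\<^bsub>A\<^esub> = \<zero>\<^bsub>B\<^esub>" "f \<one>\<^bsub>A\<^esub> = \<one>\<^bsub>B\<^esub>"
    using iso unfolding bz_iso_def by blast
  interpret B: antiortholattice B by (rule B)
  have "central_pbz A"
    unfolding central_pbz_iff_identities
    using A B.satisfies_central_pbz_identities bz_iso_satisfies[OF iso] by blast
  then interpret A: central_pbz A .
  have "x = \<zero>\<^bsub>A\<^esub> \<or> x = \<one>\<^bsub>A\<^esub>" if "sharp A x" for x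
  proof -
    have x: "x \<in> carrier A" "x \<squnion>\<^bsub>A\<^esub> kcomp A x = \<one>\<^bsub>A\<^esub>"
      using that by (auto simp: sharp_def)
    have "f x \<squnion>\<^bsub>B\<^esub> kcomp B (f x) = f (x \<squnion>\<^bsub>A\<^esub> kcomp A x)"
      using x(1) A.kcomp_closed f(2,3) by simp
    then have "sharp B (f x)"
      using x f(6) bij by (auto simp: sharp_def bij_betw_def)
    then have "f x = f \<zero>\<^bsub>A\<^esub> \<or> f x = f \<one>\<^bsub>A\<^esub>"
      using B.sharp_trivial f by simp
    then show ?thesis
      using bij x(1) A.zero_closed A.one_closed by (auto simp: bij_betw_def inj_on_def)
  qed
  then show ?thesis by unfold_locales
qed

text \<open>
  Merging the two middle elements of \<open>D 4\<close> is a congruence: the involution swaps them, and both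
  have Brouwer complement \<open>0\<close>.
\<close>

lemma D4_satisfies_imp_D3:
  assumes "satisfies (D 4) e"
  shows "satisfies (D 3) e"
proof (rule satisfies_compatible[OF _ _ _ assms])
  let ?R = "\<lambda>a b. a < 4 \<and> b = (if a = 0 then 0 else if a = 3 then 2 else 1 :: nat)"
  show "compatible (D 4) (D 3) ?R"
    unfolding compatible_def by (auto simp: min_def max_def)
  show "\<exists>a\<in>carrier (D 4). ?R a b" if "b \<in> carrier (D 3)" for b
  proof -
    have "b = 0 \<or> b = 1 \<or> b = 2" using that by auto
    then show ?thesis
      by (elim disjE) (rule bexI[of _ "if b = 2 then 3 else b"]; simp)+
  qed
qed auto

context central_pbz
begin

text \<open>
  A copy, given by \<open>\<phi>\<close>, of a subalgebra \<open>T\<close> of \<open>D n\<close> inside the interval below \<open>bcomp L z\<close>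
  turns the homomorphism onto that interval into a compatible relation with \<open>D n\<close>. Since both
  sides are chains, order preservation gives the lattice operations. Allowing a proper
  \<open>T\<close> covers intervals in which the middle of \<open>D 3\<close> has no counterpart.
\<close>

lemma compatible_chain:
  assumes z: "z \<in> carrier L"
    and T: "T \<subseteq> {..<n}" "0 \<in> T" "n - 1 \<in> T" "\<And>d. d \<in> T \<Longrightarrow> n - 1 - d \<in> T"
    and \<phi>: "\<And>d. d \<in> T \<Longrightarrow> \<phi> d \<in> carrier L" "\<phi> 0 = \<zero>" "\<phi> (n - 1) = bcomp L z"
    and mono: "\<And>d e. \<lbrakk>d \<in> T; e \<in> T; d < e\<rbrakk> \<Longrightarrow> \<phi> d \<sqsubseteq> \<phi> e"
    and kcomp: "\<And>d. d \<in> T \<Longrightarrow> kcomp L (\<phi> d) \<sqinter> bcomp L z = \<phi> (n - 1 - d)"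
    and bcomp: "\<And>d. \<lbrakk>d \<in> T; d \<noteq> 0\<rbrakk> \<Longrightarrow> bcomp L (\<phi> d) \<sqinter> bcomp L z = \<zero>"
  shows "compatible L (D n) (\<lambda>a d. a \<in> carrier L \<and> d \<in> T \<and> a \<sqinter> bcomp L z = \<phi> d)"
proof -
  have s: "bcomp L z \<in> carrier L" using z by (rule bcomp_closed)
  have chain: "\<phi> d \<sqinter> \<phi> e = \<phi> (min d e) \<and> \<phi> d \<squnion> \<phi> e = \<phi> (max d e)" if de: "d \<in> T" "e \<in> T" for d e
  proof (cases d e rule: linorder_cases)
    case less
    then have "\<phi> d \<sqsubseteq> \<phi> e" using de mono by blast
    then show ?thesis using less de \<phi>(1) leq_iff_join[of "\<phi> d" "\<phi> e"] by (simp add: leq_def)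
  next
    case equal
    then show ?thesis using de \<phi>(1) leq_refl leq_iff_join[of "\<phi> d" "\<phi> e"] by (simp add: leq_def)
  next
    case greater
    then have "\<phi> e \<sqsubseteq> \<phi> d" using de mono by blast
    then show ?thesis
      using greater de \<phi>(1) leq_iff_join[of "\<phi> e" "\<phi> d"] meet_commute[of "\<phi> d" "\<phi> e"]
        join_commute[of "\<phi> d" "\<phi> e"]
      by (simp add: leq_def)
  qed
  have bcomp': "bcomp L (\<phi> d) \<sqinter> bcomp L z = \<phi> (if d = 0 then n - 1 else 0)" if "d \<in> T" for d
    using that \<phi> bcomp s by (simp add: bcomp_zero meet_one)
  have minmax: "min d e \<in> T \<and> max d e \<in> T" if "d \<in> T" "e \<in> T" for d e
    using that by (simp add: min_def max_def)
  have "(a \<sqinter> b) \<sqinter> bcomp L z = \<phi> (min d e) \<and> (a \<squnion> b) \<sqinter> bcomp L z = \<phi> (max d e)"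
    if "a \<in> carrier L" "b \<in> carrier L" "a \<sqinter> bcomp L z = \<phi> d" "b \<sqinter> bcomp L z = \<phi> e" "d \<in> T" "e \<in> T"
    for a b d e
    using that chain[of d e] z s by (simp add: meet_meet_distrib central_join)
  moreover have "kcomp L a \<sqinter> bcomp L z = \<phi> (n - 1 - d)
      \<and> bcomp L a \<sqinter> bcomp L z = \<phi> (if d = 0 then n - 1 else 0)"
    if "a \<in> carrier L" "a \<sqinter> bcomp L z = \<phi> d" "d \<in> T" for a d
    using that kcomp[of d] bcomp'[of d] central_kcomp[of a z] central_bcomp[of a z] z by simp
  ultimately show ?thesis
    unfolding compatible_def D_simps
    using T \<phi> s minmax
    by (simp add: zero_closed one_closed meet_zero meet_one meet_closed join_closed kcomp_closed
        bcomp_closed)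
qed

end

section \<open>The flat identity\<close>

definition flat_identity :: "bz_term \<times> bz_term" where
  "flat_identity = (let x = Var 0; m = Meet x (KComp x) in
    (Meet (Join x (KComp x)) (BComp (BComp m)), m))"

lemma satisfies_flat_identity:
  "satisfies A flat_identity \<longleftrightarrow> (\<forall>x\<in>carrier A.
     (x \<squnion>\<^bsub>A\<^esub> kcomp A x) \<sqinter>\<^bsub>A\<^esub> bcomp A (bcomp A (x \<sqinter>\<^bsub>A\<^esub> kcomp A x)) = x \<sqinter>\<^bsub>A\<^esub> kcomp A x)"
  (is "_ \<longleftrightarrow> (\<forall>x\<in>_. ?P x)")
proof
  assume A: "satisfies A flat_identity"
  show "\<forall>x\<in>carrier A. ?P x"
  proof
    fix x assume "x \<in> carrier A"
    then have "range (\<lambda>_. x) \<subseteq> carrier A" by auto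
    then show "?P x" using A unfolding satisfies_def flat_identity_def Let_def by force
  qed
next
  assume "\<forall>x\<in>carrier A. ?P x"
  then show "satisfies A flat_identity"
    unfolding satisfies_def flat_identity_def Let_def by (auto simp: image_subset_iff)
qed

lemma D3_flat: "satisfies (D 3) flat_identity"
  unfolding satisfies_flat_identity by (auto simp: min_def max_def)

lemma D4_not_flat: "\<not> satisfies (D 4) flat_identity"
  unfolding satisfies_flat_identity by (auto intro!: bexI[of _ 1])

context central_pbz
begin

text \<open>
  With \<open>b = a \<sqinter> a'\<close> the left-hand side of the flat identity at \<open>a\<close> is \<open>c = b' \<sqinter> s\<close>, the
  relative involute of \<open>b\<close> in the interval below \<open>s\<close>. Thus a failure of the identity says exactly
  \<open>b \<noteq> c\<close>, and \<open>\<zero>, b, c, s\<close> is a copy of \<open>D 4\<close>.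
\<close>

lemma satisfies_D4_if_not_flat:
  assumes not_flat: "\<not> satisfies L flat_identity" and L: "satisfies L e"
  shows "satisfies (D 4) e"
proof -
  obtain a where a: "a \<in> carrier L"
    and neq: "(a \<squnion> kcomp L a) \<sqinter> bcomp L (bcomp L (a \<sqinter> kcomp L a)) \<noteq> a \<sqinter> kcomp L a"
    using not_flat unfolding satisfies_flat_identity by blast
  define b where "b = a \<sqinter> kcomp L a"
  define z where "z = bcomp L b"
  define s where "s = bcomp L z"
  define c where "c = kcomp L b \<sqinter> s"
  note cl = meet_closed join_closed kcomp_closed bcomp_closed zero_closed one_closed
  have b: "b \<in> carrier L" and z: "z \<in> carrier L" and s: "s \<in> carrier L" and c: "c \<in> carrier L"
    using a by (simp_all add: b_def z_def s_def c_def cl)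
  have kb: "kcomp L b = a \<squnion> kcomp L a"
    using a by (simp add: b_def kcomp_meet cl kcomp_involutive join_commute)
  have bs: "b \<sqsubseteq> s"
    using le_bcomp_bcomp[OF b] by (simp add: s_def z_def)
  have "b \<sqsubseteq> kcomp L b"
    using kleene[OF a a] kb by (simp add: b_def)
  then have bc: "b \<sqsubseteq> c"
    using bs b s by (simp add: c_def meet_greatest cl)
  have cs: "c \<sqsubseteq> s"
    using b s by (simp add: c_def meet_lower2 cl)
  have b_neq_c: "b \<noteq> c"
    using neq kb by (simp add: b_def c_def s_def z_def)
  have kc: "kcomp L c \<sqinter> s = b"
    using central_kcomp[of "kcomp L b" z] b z bs
    by (simp add: c_def s_def[symmetric] cl kcomp_involutive leq_def)
  have b0: "b \<noteq> \<zero>"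
  proof
    assume "b = \<zero>"
    then have "c = \<zero>"
      by (simp add: c_def s_def z_def bcomp_zero bcomp_one kcomp_zero meet_one zero_closed)
    then show False using b_neq_c \<open>b = \<zero>\<close> by simp
  qed
  have ks: "kcomp L s \<sqinter> s = \<zero>"
    using central_kcomp[of \<one> z] z s by (simp add: s_def[symmetric] cl kcomp_one meet_one meet_zero)
  have c_neq_s: "c \<noteq> s"
    using kc ks b0 by auto
  \<comment> \<open>The interval below \<open>s\<close> is where \<open>b\<close> is dense: there everything above \<open>b\<close> has Brouwer complement \<open>\<zero>\<close>.\<close>
  have small: "bcomp L y \<sqinter> s = \<zero>" if y: "y \<in> carrier L" "b \<sqsubseteq> y" for y
  proof -
    have "bcomp L y \<sqsubseteq> z" unfolding z_def using y b by (simp add: bcomp_antitone)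
    then have "bcomp L y \<sqinter> s = bcomp L y \<sqinter> (z \<sqinter> s)"
      using y z s meet_assoc[of "bcomp L y" z s] by (simp add: leq_def cl)
    also have "\<dots> = \<zero>"
      using y z by (simp add: s_def meet_bcomp meet_zero cl)
    finally show ?thesis .
  qed
  define \<phi> where "\<phi> d = (if d = 0 then \<zero> else if d = 1 then b else if d = 2 then c else s)" for d :: nat
  have bs': "b \<sqsubseteq> b" using b by (rule leq_refl)
  have T: "d \<in> {..<4} \<longleftrightarrow> d = 0 \<or> d = 1 \<or> d = 2 \<or> d = (3::nat)" for d by auto
  have "compatible L (D 4) (\<lambda>a d. a \<in> carrier L \<and> d \<in> {..<4} \<and> a \<sqinter> bcomp L z = \<phi> d)"
  proof (rule compatible_chain[OF z])
    show "\<phi> d \<sqsubseteq> \<phi> e" if "d \<in> {..<4}" "e \<in> {..<4}" "d < e" for d e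
      using that bs bc cs b c s unfolding T by (auto simp: \<phi>_def zero_least)
    show "kcomp L (\<phi> d) \<sqinter> bcomp L z = \<phi> (4 - 1 - d)" if "d \<in> {..<4}" for d
      using that kc ks s unfolding T s_def[symmetric]
      by (auto simp: \<phi>_def kcomp_zero meet_one c_def)
    show "bcomp L (\<phi> d) \<sqinter> bcomp L z = \<zero>" if "d \<in> {..<4}" "d \<noteq> 0" for d
      using that small[OF b bs'] small[OF c bc] small[OF s bs] unfolding T s_def[symmetric]
      by (auto simp: \<phi>_def)
  qed (auto simp: \<phi>_def s_def zero_closed b c s[unfolded s_def])
  then show ?thesis
  proof (rule satisfies_compatible[OF _ _ _ L])
    fix d assume d: "d \<in> carrier (D 4)"
    then have "\<phi> d \<in> carrier L" "\<phi> d \<sqinter> s = \<phi> d"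
      using b c s bs cs by (auto simp: \<phi>_def zero_closed meet_zero meet_idem leq_def)
    then show "\<exists>a\<in>carrier L. a \<in> carrier L \<and> d \<in> {..<4} \<and> a \<sqinter> bcomp L z = \<phi> d"
      using d by (auto simp: s_def)
  next
    have "c \<noteq> \<zero>" "s \<noteq> \<zero>" "b \<noteq> s"
      using b0 b_neq_c b c s bc cs bs by (auto simp: leq_def meet_zero meet_commute)
    then have "d = e" if "\<phi> d = \<phi> e" "d \<in> {..<4}" "e \<in> {..<4}" for d e
      using that b0 b_neq_c c_neq_s unfolding T by (auto simp: \<phi>_def)
    then show "d = e"
      if "a \<in> carrier L \<and> d \<in> {..<4} \<and> a \<sqinter> bcomp L z = \<phi> d"
        "a \<in> carrier L \<and> e \<in> {..<4} \<and> a \<sqinter> bcomp L z = \<phi> e" for a d e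
      using that by metis
  qed
qed

text \<open>
  An equation can be checked piecewise: the parts below \<open>bcomp L w\<close> and
  \<open>bcomp L (bcomp L w)\<close> determine an element, so each \<open>w \<in> F\<close> in turn may be assumed decided.
  Every piece is again below a single Brouwer complement, as
  \<open>bcomp L u \<sqinter> bcomp L x = bcomp L (u \<squnion> x)\<close>.
\<close>

lemma eq_by_central_splitting:
  assumes "finite F" and "F \<subseteq> carrier L" and p: "p \<in> carrier L" and q: "q \<in> carrier L"
    and "u \<in> carrier L"
    and "\<And>z. \<lbrakk>z \<in> carrier L; bcomp L z \<sqsubseteq> bcomp L u;
          \<And>w. w \<in> F \<Longrightarrow> bcomp L z \<sqsubseteq> bcomp L w \<or> bcomp L z \<sqsubseteq> bcomp L (bcomp L w)\<rbrakk>
        \<Longrightarrow> p \<sqinter> bcomp L z = q \<sqinter> bcomp L z"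
  shows "p \<sqinter> bcomp L u = q \<sqinter> bcomp L u"
  using assms(1,2,5,6)
proof (induction F arbitrary: u rule: finite_induct)
  case empty
  then show ?case using leq_refl bcomp_closed by simp
next
  case (insert w F)
  note u = \<open>u \<in> carrier L\<close>
  have w: "w \<in> carrier L" using insert.prems by simp
  have step: "p \<sqinter> bcomp L (u \<squnion> x) = q \<sqinter> bcomp L (u \<squnion> x)" if x: "x = w \<or> x = bcomp L w" for x
  proof (rule insert.IH)
    have x': "x \<in> carrier L" using x w bcomp_closed by auto
    show "F \<subseteq> carrier L" "u \<squnion> x \<in> carrier L"
      using insert.prems x' by (simp_all add: join_closed)
    fix z assume z: "z \<in> carrier L" "bcomp L z \<sqsubseteq> bcomp L (u \<squnion> x)"
      and dec: "\<And>w. w \<in> F \<Longrightarrow> bcomp L z \<sqsubseteq> bcomp L w \<or> bcomp L z \<sqsubseteq> bcomp L (bcomp L w)"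
    have le: "bcomp L z \<sqsubseteq> bcomp L u" "bcomp L z \<sqsubseteq> bcomp L x"
      using z u x' leq_trans[of "bcomp L z" "bcomp L u \<sqinter> bcomp L x"]
      by (simp_all add: bcomp_join bcomp_closed meet_closed meet_lower1 meet_lower2)
    show "p \<sqinter> bcomp L z = q \<sqinter> bcomp L z"
      by (rule insert.prems(3)[OF z(1) le(1)]) (use x le(2) dec in auto)
  qed
  have join: "y \<sqinter> bcomp L u
      = (y \<sqinter> bcomp L (u \<squnion> w)) \<squnion> (y \<sqinter> bcomp L (u \<squnion> bcomp L w))" if y: "y \<in> carrier L" for y
    using central_split[of "y \<sqinter> bcomp L u" w] y u w
    by (simp add: bcomp_join meet_assoc meet_closed bcomp_closed)
  show ?case
    using step by (simp add: join[OF p] join[OF q])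
qed

text \<open>
  Below \<open>bcomp L a\<close> the element \<open>a\<close> vanishes, and below the Brouwer complement of its involute it
  is the top. In the remaining case the interval lies below \<open>(a \<sqinter> a')\<^sup>~\<^sup>~\<close>, where the flat
  identity makes the join of \<open>a\<close> and \<open>a'\<close> equal to their meet.
\<close>

lemma flat_trichotomy:
  assumes flat: "satisfies L flat_identity" and a: "a \<in> carrier L" and z: "z \<in> carrier L"
    and dec: "bcomp L z \<sqsubseteq> bcomp L a \<or> bcomp L z \<sqsubseteq> bcomp L (bcomp L a)"
    and dec': "bcomp L z \<sqsubseteq> bcomp L (kcomp L a) \<or> bcomp L z \<sqsubseteq> bcomp L (bcomp L (kcomp L a))"
  shows "a \<sqinter> bcomp L z = \<zero> \<or> a \<sqinter> bcomp L z = bcomp L z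
    \<or> (kcomp L a \<sqinter> bcomp L z = a \<sqinter> bcomp L z \<and> bcomp L a \<sqinter> bcomp L z = \<zero>)"
proof -
  define s where "s = bcomp L z"
  define k where "k = kcomp L a"
  note cl = meet_closed join_closed kcomp_closed bcomp_closed
  have s: "s \<in> carrier L" and k: "k \<in> carrier L" using z a by (simp_all add: s_def k_def cl)
  have disjoint: "y \<sqinter> s = \<zero>" if y: "y \<in> carrier L" "s \<sqsubseteq> bcomp L y" for y
  proof -
    have "y \<sqinter> s = y \<sqinter> bcomp L y \<sqinter> s"
      using y s meet_commute[of s "bcomp L y"] by (simp add: meet_assoc cl leq_def)
    then show ?thesis using y s by (simp add: meet_bcomp meet_zero)
  qed
  consider "s \<sqsubseteq> bcomp L a" | "s \<sqsubseteq> bcomp L k"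
    | "s \<sqsubseteq> bcomp L (bcomp L a)" "s \<sqsubseteq> bcomp L (bcomp L k)"
    using dec dec' unfolding s_def k_def by blast
  then show ?thesis
  proof cases
    case 1
    then show ?thesis using disjoint[OF a] by (simp add: s_def)
  next
    case 2
    then have "k \<sqinter> s = \<zero>" using disjoint[OF k] by simp
    then have "a \<sqinter> s = s"
      using central_kcomp[OF k z] s a
      by (simp add: s_def[symmetric] kcomp_zero meet_one k_def kcomp_involutive)
    then show ?thesis by (simp add: s_def)
  next
    case 3
    define t where "t = bcomp L (bcomp L (a \<sqinter> k))"
    \<comment> \<open>This is where the star axiom enters.\<close>
    have t: "t = bcomp L (bcomp L a) \<sqinter> bcomp L (bcomp L k)"
      using a k by (simp add: t_def k_def star bcomp_join cl)
    have tc: "t \<in> carrier L" using a k by (simp add: t_def cl)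
    have "s \<sqsubseteq> t" using 3 a k s by (simp add: t meet_greatest cl)
    then have ts: "t \<sqinter> s = s" using tc s meet_commute[of t s] by (simp add: leq_def)
    have "(a \<squnion> k) \<sqinter> t = a \<sqinter> k"
      using flat a unfolding satisfies_flat_identity t_def k_def by blast
    then have "(a \<squnion> k) \<sqinter> s = (a \<sqinter> k) \<sqinter> s"
      using meet_assoc[of "a \<squnion> k" t s] ts a k tc s by (simp add: cl)
    then have eq: "(a \<sqinter> s) \<squnion> (k \<sqinter> s) = (a \<sqinter> s) \<sqinter> (k \<sqinter> s)"
      using a k z s by (simp add: central_join meet_meet_distrib s_def)
    have "x = y" if "x \<in> carrier L" "y \<in> carrier L" "x \<squnion> y = x \<sqinter> y" for x y
      using that by (metis join_upper1 join_upper2 leq_antisym leq_trans meet_closed meet_lower1 meet_lower2)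
    then have "k \<sqinter> s = a \<sqinter> s" using eq a k s by (metis cl(1))
    moreover have "bcomp L a \<sqinter> s = \<zero>" using disjoint[of "bcomp L a"] 3 a by (simp add: cl)
    ultimately show ?thesis by (simp add: s_def k_def)
  qed
qed

text \<open>
  The Kleene law puts any fixed point \<open>a = a \<sqinter> a'\<close> below any other, \<open>b = b \<squnion> b'\<close>.
\<close>

lemma fixed_point_unique:
  assumes cl: "a \<in> carrier L" "b \<in> carrier L" "z \<in> carrier L"
    and sym: "kcomp L a \<sqinter> bcomp L z = a \<sqinter> bcomp L z" "kcomp L b \<sqinter> bcomp L z = b \<sqinter> bcomp L z"
  shows "a \<sqinter> bcomp L z = b \<sqinter> bcomp L z"
proof -
  have le: "x \<sqinter> bcomp L z \<sqsubseteq> y \<sqinter> bcomp L z"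
    if x: "x \<in> carrier L" and y: "y \<in> carrier L"
      and kx: "kcomp L x \<sqinter> bcomp L z = x \<sqinter> bcomp L z"
      and ky: "kcomp L y \<sqinter> bcomp L z = y \<sqinter> bcomp L z" for x y
  proof -
    have s: "bcomp L z \<in> carrier L" using cl by (simp add: bcomp_closed)
    have xs: "x \<sqinter> bcomp L z \<in> carrier L" and ys: "y \<sqinter> bcomp L z \<in> carrier L"
      using x y s by (simp_all add: meet_closed)
    have "(x \<sqinter> kcomp L x) \<sqinter> bcomp L z = x \<sqinter> bcomp L z"
      using x s xs kx by (simp add: meet_meet_distrib kcomp_closed meet_idem)
    moreover have "(y \<squnion> kcomp L y) \<sqinter> bcomp L z = y \<sqinter> bcomp L z"
      using y cl(3) ys ky leq_refl[OF ys] leq_iff_join[OF ys ys]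
      by (simp add: central_join kcomp_closed)
    ultimately show ?thesis
      using meet_meet_distrib[of "x \<sqinter> kcomp L x" "y \<squnion> kcomp L y" "bcomp L z"] kleene[OF x y] x y s
      by (simp add: leq_def meet_closed join_closed kcomp_closed)
  qed
  show ?thesis
    by (rule leq_antisym) (simp_all add: le cl sym meet_closed bcomp_closed)
qed

text \<open>
  After splitting along the Brouwer complements of the values of the variables and of their
  involutes, each value is the bottom, the top, or the fixed point of an interval, so both terms are
  evaluated in a copy of a subalgebra of \<open>D 3\<close>.
\<close>

lemma satisfies_if_flat:
  assumes flat: "satisfies L flat_identity" and D3: "satisfies (D 3) e"
  shows "satisfies L e"
  unfolding satisfies_def
proof (intro allI impI)
  fix v :: "nat \<Rightarrow> 'a" assume v: "range v \<subseteq> carrier L"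
  define V where "V = term_vars (fst e) \<union> term_vars (snd e)"
  let ?p = "interp L v (fst e)" and ?q = "interp L v (snd e)"
  have vi: "v i \<in> carrier L" for i using v by auto
  have pq: "?p \<in> carrier L" "?q \<in> carrier L" using interp_closed[OF v] by auto
  \<comment> \<open>The whole algebra is the interval below \<open>bcomp L \<zero> = \<one>\<close>.\<close>
  have "?p \<sqinter> bcomp L \<zero> = ?q \<sqinter> bcomp L \<zero>"
  proof (rule eq_by_central_splitting[of "v ` V \<union> kcomp L ` v ` V"])
    fix z assume z: "z \<in> carrier L"
      and dec: "\<And>w. w \<in> v ` V \<union> kcomp L ` v ` V
        \<Longrightarrow> bcomp L z \<sqsubseteq> bcomp L w \<or> bcomp L z \<sqsubseteq> bcomp L (bcomp L w)"
    define s where "s = bcomp L z"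
    have s: "s \<in> carrier L" using z by (simp add: s_def bcomp_closed)
    define mid where "mid a \<longleftrightarrow> kcomp L a \<sqinter> s = a \<sqinter> s \<and> bcomp L a \<sqinter> s = \<zero>" for a
    have tri: "v i \<sqinter> s = \<zero> \<or> v i \<sqinter> s = s \<or> mid (v i)" if "i \<in> V" for i
      using flat_trichotomy[OF flat vi z dec dec, of i] that by (auto simp: s_def mid_def)
    \<comment> \<open>If no variable takes the middle value, the interval need not have a fixed point, and \<open>{0, 2}\<close> suffices.\<close>
    define T where "T = (if \<exists>i\<in>V. mid (v i) then {0, 1, 2} else {0, 2 :: nat})"
    \<comment> \<open>All fixed points agree on the interval, so any variable with a middle value can represent them.\<close>
    define m where "m = (SOME i. i \<in> V \<and> mid (v i))"
    have m: "mid (v m)" if "1 \<in> T"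
    proof -
      have "\<exists>i. i \<in> V \<and> mid (v i)" using that by (auto simp: T_def split: if_splits)
      then show ?thesis unfolding m_def by (rule someI2_ex) blast
    qed
    define \<phi> where "\<phi> d = (if d = 0 then \<zero> else if d = 1 then v m \<sqinter> s else s)" for d :: nat
    have T: "T \<subseteq> {..<3}" "0 \<in> T" "2 \<in> T" by (auto simp: T_def)
    have T': "d = 0 \<or> d = 1 \<and> 1 \<in> T \<or> d = 2" if "d \<in> T" for d
      using that by (auto simp: T_def split: if_splits)
    have ks: "kcomp L s \<sqinter> s = \<zero>"
      using central_kcomp[of \<one> z] z s
      by (simp add: s_def[symmetric] one_closed kcomp_one meet_one meet_zero)
    have bs: "bcomp L s \<sqinter> s = \<zero>"
      using meet_bcomp[OF s] meet_commute[OF s bcomp_closed[OF s]] by simp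
    have ms: "v m \<sqinter> s \<in> carrier L" using vi s by (simp add: meet_closed)
    have km: "kcomp L (v m \<sqinter> s) \<sqinter> s = v m \<sqinter> s" "bcomp L (v m \<sqinter> s) \<sqinter> s = \<zero>" if "1 \<in> T"
      using m[OF that] central_kcomp[OF vi z, of m] central_bcomp[OF vi z, of m]
      by (simp_all add: s_def mid_def)
    let ?R = "\<lambda>a d. a \<in> carrier L \<and> d \<in> T \<and> a \<sqinter> bcomp L z = \<phi> d"
    have R: "compatible L (D 3) ?R"
    proof (rule compatible_chain[OF z])
      show "3 - 1 - d \<in> T" if "d \<in> T" for d using T'[OF that] T by auto
      show "\<phi> d \<in> carrier L" for d using ms s by (simp add: \<phi>_def zero_closed)
      show "\<phi> d \<sqsubseteq> \<phi> e" if "d \<in> T" "e \<in> T" "d < e" for d e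
        using that(3) T'[OF that(1)] T'[OF that(2)] ms s vi
        by (auto simp: \<phi>_def zero_least meet_lower2)
      show "kcomp L (\<phi> d) \<sqinter> bcomp L z = \<phi> (3 - 1 - d)" if "d \<in> T" for d
        using T'[OF that] km ks s
        by (auto simp: \<phi>_def s_def[symmetric] kcomp_zero meet_one)
      show "bcomp L (\<phi> d) \<sqinter> bcomp L z = \<zero>" if "d \<in> T" "d \<noteq> 0" for d
        using T'[OF that(1)] that(2) km bs by (auto simp: \<phi>_def s_def[symmetric])
    qed (use T in \<open>auto simp: \<phi>_def s_def\<close>)
    have "\<exists>d\<in>T. v i \<sqinter> s = \<phi> d" if i: "i \<in> V" for i
    proof (cases "mid (v i)")
      case True
      then have "1 \<in> T" using i by (auto simp: T_def)
      moreover have "v i \<sqinter> s = v m \<sqinter> s"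
        using fixed_point_unique[OF vi vi z] m[OF \<open>1 \<in> T\<close>] True by (simp add: mid_def s_def)
      ultimately show ?thesis by (auto simp: \<phi>_def)
    next
      case False
      moreover have "\<phi> 0 = \<zero>" "\<phi> 2 = s" by (simp_all add: \<phi>_def)
      ultimately show ?thesis using tri[OF i] T(2,3) by metis
    qed
    then obtain u0 where u0: "\<And>i. i \<in> V \<Longrightarrow> u0 i \<in> T \<and> v i \<sqinter> s = \<phi> (u0 i)" by metis
    \<comment> \<open>Variables that do not occur still need a value in \<open>D 3\<close>.\<close>
    define u where "u i = (if i \<in> V then u0 i else 0)" for i
    have "u i \<in> T" for i using u0 T by (simp add: u_def)
    then have "range u \<subseteq> carrier (D 3)" using T(1) by auto
    then have "interp (D 3) u (fst e) = interp (D 3) u (snd e)"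
      using D3 by (simp add: satisfies_def)
    moreover have Ri: "?R (v i) (u i)" if "i \<in> V" for i
      using u0[OF that] vi that by (simp add: u_def s_def)
    have "?R (interp L v t) (interp (D 3) u t)" if "term_vars t \<subseteq> V" for t
      by (rule compatible_interp[OF R]) (use that Ri in blast)
    then have "?R ?p (interp (D 3) u (fst e))" "?R ?q (interp (D 3) u (snd e))"
      by (simp_all add: V_def)
    ultimately show "?p \<sqinter> bcomp L z = ?q \<sqinter> bcomp L z" by simp
  qed (use vi pq kcomp_closed zero_closed finite_term_vars in \<open>auto simp: V_def\<close>)
  then show "?p = ?q"
    using pq by (simp add: bcomp_zero meet_one)
qed

end

section \<open>The cover\<close>

lemma D4_mem_above_D3:
  fixes D3 D4 :: "'a bz_alg"
  assumes D3: "bz_iso D3 (D 3)" and D4: "bz_iso D4 (D 4)"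
    and W: "variety W" and gt: "V_BZL {D3} < W" and le: "W \<subseteq> V_BZL AOL"
  shows "D4 \<in> W"
proof -
  have alg: "bz_algebra D3" "bz_algebra D4" using D3 D4 by (auto simp: bz_iso_def)
  obtain E where E: "W = {A. bz_algebra A \<and> (\<forall>e\<in>E. satisfies A e)}"
    using W unfolding variety_def by blast
  obtain A where A: "A \<in> W" "A \<notin> V_BZL {D3}" using gt by blast
  interpret central_pbz A using A(1) le V_AOL_central_pbz by blast
  have "\<not> satisfies A flat_identity"
  proof
    assume "satisfies A flat_identity"
    then have "satisfies A e" if "satisfies D3 e" for e
      using that satisfies_if_flat bz_iso_satisfies[OF D3] by blast
    then have "A \<in> V_BZL {D3}"
      using V_BZL_eq[of "{D3}"] alg bz_algebra_axioms by auto
    then show False using A(2) by simp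
  qed
  then have "satisfies D4 e" if "e \<in> E" for e
    using that A(1) E satisfies_D4_if_not_flat bz_iso_satisfies[OF D4] by blast
  then show ?thesis using E alg by simp
qed

theorem theorem17:
  fixes D3 D4 :: "'a bz_alg"
  assumes "infinite (UNIV :: 'a set)"
    and "bz_iso D3 (D 3)"
    and "bz_iso D4 (D 4)"
  shows "{W. cover_in (subvarieties PBZL_star) (V_BZL {D3}) W \<and> W \<subseteq> V_BZL AOL} = {V_BZL {D4}}"
proof -
  have alg: "bz_algebra D3" "bz_algebra D4" using assms(2,3) by (auto simp: bz_iso_def)
  have var: "variety (V_BZL {D3})" "variety (V_BZL {D4})"
    using variety_V_BZL[of "{D3}"] variety_V_BZL[of "{D4}"] alg by auto
  have mem: "A \<in> V_BZL {B} \<longleftrightarrow> bz_algebra A \<and> (\<forall>e. satisfies B e \<longrightarrow> satisfies A e)"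
    if "bz_algebra B" for A B :: "'a bz_alg"
    using V_BZL_eq[of "{B}"] that by auto
  have "D3 \<in> V_BZL {D4}"
    using mem alg D4_satisfies_imp_D3 bz_iso_satisfies assms(2,3) by blast
  moreover have "D4 \<notin> V_BZL {D3}"
    using mem alg D3_flat D4_not_flat bz_iso_satisfies assms(2,3) by blast
  ultimately have less: "V_BZL {D3} < V_BZL {D4}"
    using V_BZL_least[of "V_BZL {D4}" "{D3}"] var V_BZL_superset[of "{D4}"] by blast
  have "variety (V_BZL AOL :: 'a bz_alg set)"
    using variety_V_BZL antiortholattice_bz_algebra by blast
  moreover have "D4 \<in> AOL"
    using antiortholattice_iso[OF assms(3) D_antiortholattice] by (simp add: AOL_def)
  ultimately have D4_AOL: "V_BZL {D4} \<subseteq> V_BZL AOL"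
    using V_BZL_least[of "V_BZL AOL" "{D4}"] V_BZL_superset[of AOL] by blast
  have "V_BZL AOL \<subseteq> (PBZL_star :: 'a bz_alg set)"
    using V_AOL_central_pbz by (auto simp: PBZL_star_def central_pbz_def)
  then have sub: "V_BZL {D3} \<in> subvarieties PBZL_star" "V_BZL {D4} \<in> subvarieties PBZL_star"
    using var less D4_AOL by (auto simp: subvarieties_def)
  have least: "V_BZL {D4} \<subseteq> W"
    if "W \<in> subvarieties PBZL_star" "V_BZL {D3} < W" "W \<subseteq> V_BZL AOL" for W
    using that D4_mem_above_D3[OF assms(2,3)] V_BZL_least[of W "{D4}"]
    by (auto simp: subvarieties_def)
  show ?thesis
  proof (intro set_eqI iffI)
    fix W assume "W \<in> {W. cover_in (subvarieties PBZL_star) (V_BZL {D3}) W \<and> W \<subseteq> V_BZL AOL}"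
    then have "V_BZL {D4} \<subseteq> W" and "\<not> V_BZL {D4} < W"
      using least sub less by (auto simp: cover_in_def)
    then show "W \<in> {V_BZL {D4}}" by auto
  next
    fix W assume "W \<in> {V_BZL {D4}}"
    moreover have "cover_in (subvarieties PBZL_star) (V_BZL {D3}) (V_BZL {D4})"
      unfolding cover_in_def using sub less least D4_AOL by (meson leD less_imp_le order_trans)
    ultimately show "W \<in> {W. cover_in (subvarieties PBZL_star) (V_BZL {D3}) W \<and> W \<subseteq> V_BZL AOL}"
      using D4_AOL by simp
  qed
qed

end
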